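(* Let $\varepsilon,\mu,\omega>0$ be constants, $\sigma=0$, $\tilde\omega=\omega\sqrt{\varepsilon\mu}$, $Z=\sqrt{\mu/\varepsilon}$, $L\ge0$, $\Omega_1=(-\infty,L)\times\mathbb{R}^2$, $\Omega_2=(0,\infty)\times\mathbb{R}^2$, $\Gamma_{12}=\{L\}\times\mathbb{R}^2$, $\Gamma_{21}=\{0\}\times\mathbb{R}^2$. Consider the optimized Schwarz algorithm which for $n=1,2,\dots$ solves $$-i\omega\varepsilon\boldsymbol{E}^{j,n}+\mathrm{curl}\,\boldsymbol{H}^{j,n}=\boldsymbol{J},\qquad i\omega\mu\boldsymbol{H}^{j,n}+\mathrm{curl}\,\boldsymbol{E}^{j,n}=\boldsymbol{0}\qquad\text{in }\Omega_j,\ j=1,2,$$ with the radiation condition at infinity and the transmission conditions $$\boldsymbol{w}_-^{1,n}+\mathcal{S}_1\boldsymbol{w}_+^{1,n}=\boldsymbol{w}_-^{2,n-1}+\mathcal{S}_1\boldsymbol{w}_+^{2,n-1}\ \text{ on }\Gamma_{12},\qquad \boldsymbol{w}_+^{2,n}+\mathcal{S}_2\boldsymbol{w}_-^{2,n}=\boldsymbol{w}_+^{1,n-1}+\mathcal{S}_2\boldsymbol{w}_-^{1,n-1}\ \text{ on }\Gamma_{21},$$ where $\mathcal{S}_1,\mathcal{S}_2$ are operators acting in $(y,z)$ given by Fourier symbols. Set $M=\begin{bmatrix}k_y^2-k_z^2&-2k_yk_z\\-2k_yk_z&k_z^2-k_y^2\end{bmatrix}$. Then the convergence factor $\rho=\rho(\boldsymbol{k})$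 of the Fourier mode $\boldsymbol{k}=(k_y,k_z)$ is as follows. 1. If $\mathcal{F}(\mathcal{S}_l)=\gamma_l M$ with $\gamma_l\in\mathbb{C}(k_z,k_y)$, $l=1,2$, then $$\rho=\left|\frac{(\sqrt{|\boldsymbol{k}|^2-\tilde\omega^2}-i\tilde\omega)^2}{(\sqrt{|\boldsymbol{k}|^2-\tilde\omega^2}+i\tilde\omega)^2}\,\frac{1-\gamma_1(\sqrt{|\boldsymbol{k}|^2-\tilde\omega^2}+i\tilde\omega)^2}{1-\gamma_1(\sqrt{|\boldsymbol{k}|^2-\tilde\omega^2}-i\tilde\omega)^2}\,\frac{1-\gamma_2(\sqrt{|\boldsymbol{k}|^2-\tilde\omega^2}+i\tilde\omega)^2}{1-\gamma_2(\sqrt{|\boldsymbol{k}|^2-\tilde\omega^2}-i\tilde\omega)^2}\,e^{-2\sqrt{|\boldsymbol{k}|^2-\tilde\omega^2}\,L}\right|^{1/2}.$$ 2. If $\mathcal{F}(\mathcal{S}_l)=\delta_l M^{-1}$ with $\delta_l\in\mathbb{C}(k_z,k_y)$, $l=1,2$, then $$\rho=\left|\frac{(\sqrt{|\boldsymbol{k}|^2-\tilde\omega^2}+i\tilde\omega)^2}{(\sqrt{|\boldsymbol{k}|^2-\tilde\omega^2}-i\tilde\omega)^2}\,\frac{\delta_1-(\sqrt{|\boldsymbol{k}|^2-\tilde\omega^2}-i\tilde\omega)^2}{\delta_1-(\sqrt{|\boldsymbol{k}|^2-\tilde\omega^2}+i\tilde\omega)^2}\,\frac{\delta_2-(\sqrt{|\boldsymbol{k}|^2-\tilde\omega^2}-i\tilde\omega)^2}{\delta_2-(\sqrt{|\boldsymbol{k}|^2-\tilde\omega^2}+i\tilde\omega)^2}\,e^{-2\sqrt{|\boldsymbol{k}|^2-\tilde\omega^2}\,L}\right|^{1/2}.$$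 3. If $\mathcal{F}(\mathcal{S}_1)=\gamma_1 M$ and $\mathcal{F}(\mathcal{S}_2)=\delta_2 M^{-1}$ with $\gamma_1,\delta_2\in\mathbb{C}(k_z,k_y)$, then $$\rho=\left|\frac{1-\gamma_1(\sqrt{|\boldsymbol{k}|^2-\tilde\omega^2}+i\tilde\omega)^2}{1-\gamma_1(\sqrt{|\boldsymbol{k}|^2-\tilde\omega^2}-i\tilde\omega)^2}\,\frac{\delta_2-(\sqrt{|\boldsymbol{k}|^2-\tilde\omega^2}-i\tilde\omega)^2}{\delta_2-(\sqrt{|\boldsymbol{k}|^2-\tilde\omega^2}+i\tilde\omega)^2}\,e^{-2\sqrt{|\boldsymbol{k}|^2-\tilde\omega^2}\,L}\right|^{1/2}.$$
   Context: Coordinates are $(x,y,z)$; $k_y,k_z$ are the Fourier variables dual to $y,z$, and $|\boldsymbol{k}|^2=k_y^2+k_z^2$. The square root is the nonnegative one for $|\boldsymbol{k}|\ge\tilde\omega$, and $\sqrt{|\boldsymbol{k}|^2-\tilde\omega^2}=i\sqrt{\tilde\omega^2-|\boldsymbol{k}|^2}$ for $|\boldsymbol{k}|<\tilde\omega$. $\mathbb{C}(k_z,k_y)$ denotes rational functions of $k_y,k_z$ with complex coefficients. The formulas are understood at those $\boldsymbol{k}$ for which the symbols are defined and the iteration is well defined (in particular $|\boldsymbol{k}|\ne\tilde\omega$, $\boldsymbol{k}\neq 0$ where $M^{-1}$ appears, and nonvanishing denominators). Characteristic variables of a field $(\boldsymbol{E},\boldsymbol{H})$ in the $x$ direction: $\boldsymbol{w}_-=\big(-\tfrac12(\tfrac1Z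 E_2-H_3),\ \tfrac12(\tfrac1Z E_3+H_2)\big)^T$ and $\boldsymbol{w}_+=\big(\tfrac12(\tfrac1Z E_2+H_3),\ -\tfrac12(\tfrac1Z E_3-H_2)\big)^T$; superscripts $j,n$ denote those of $(\boldsymbol{E}^{j,n},\boldsymbol{H}^{j,n})$. The $2\times2$ symbols act on these vectors. Radiation condition: the Silver–Müller condition $\lim_{r\to\infty} r(Z\boldsymbol{H}\times\boldsymbol{n}-\boldsymbol{E})=0$, $r=|\boldsymbol{x}|$, $\boldsymbol{n}=\boldsymbol{x}/|\boldsymbol{x}|$. It is used in the following sense: with $\lambda=\sqrt{|\boldsymbol{k}|^2-\tilde\omega^2}$, after Fourier transform in $(y,z)$ homogeneous solutions in $\Omega_1$ contain only modes proportional to $e^{\lambda x}$ and homogeneous solutions in $\Omega_2$ only modes proportional to $e^{-\lambda x}$. Convergence factor of a mode $\boldsymbol{k}$: take $\boldsymbol{J}=\boldsymbol{0}$ (error equations) and Fourier transform in $(y,z)$. For fixed $\boldsymbol{k}$ the admissible homogeneous solutions in each subdomain form a two-dimensional complex vector space, and two consecutive steps of the algorithm (from index $n-1$ to $n+1$) define a linear map of this space to itself. The convergence factor is the square root of the spectral radius of this map. *)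

theory Defs
  imports
    "HOL-Analysis.Analysis"
    "HOL-Library.Function_Algebras"
    "HOL-Computational_Algebra.Polynomial"
    "HOL-Computational_Algebra.Fraction_Field"
begin

section \<open>Time-harmonic Maxwell equations\<close>

text \<open>Coordinates of \<open>p :: real^3\<close> are \<open>(x, y, z) = (p$1, p$2, p$3)\<close>.\<close>

type_synonym vfield = "real^3 \<Rightarrow> complex^3"
type_synonym em_field = "vfield \<times> vfield"

definition partial :: "3 \<Rightarrow> vfield \<Rightarrow> vfield" where
  "partial i F p = frechet_derivative F (at p) (axis i 1)"

definition curl :: "vfield \<Rightarrow> vfield" where
  "curl F p = vector
     [partial 2 F p $ 3 - partial 3 F p $ 2,
      partial 3 F p $ 1 - partial 1 F p $ 3,
      partial 1 F p $ 2 - partial 2 F p $ 1]"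

definition maxwell :: "real \<Rightarrow> real \<Rightarrow> real \<Rightarrow> vfield \<Rightarrow> (real^3) set \<Rightarrow> em_field \<Rightarrow> bool" where
  "maxwell \<epsilon> \<mu> \<omega> J \<Omega> = (\<lambda>(E, H). \<forall>p\<in>\<Omega>.
     E differentiable (at p) \<and> H differentiable (at p) \<and>
     - (\<i> * of_real (\<omega> * \<epsilon>)) *s E p + curl H p = J p \<and>
     (\<i> * of_real (\<omega> * \<mu>)) *s H p + curl E p = 0)"

definition Omega1 :: "real \<Rightarrow> (real^3) set" where
  "Omega1 L = {p. p $ 1 < L}"

definition Omega2 :: "(real^3) set" where
  "Omega2 = {p. 0 < p $ 1}"


section \<open>Fourier modes and operators given by symbols\<close>

text \<open>A frequency is a pair \<open>k = (k\<^sub>y, k\<^sub>z)\<close>, so that \<open>norm k\<close> is its Euclidean length and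
  \<open>k \<bullet> (y, z) = k\<^sub>y y + k\<^sub>z z\<close>. The Fourier transform is normalised so that \<open>\<partial>\<^sub>y\<close> and \<open>\<partial>\<^sub>z\<close>
  become \<open>\<i> k\<^sub>y\<close> and \<open>\<i> k\<^sub>z\<close>: a field whose transform is concentrated at \<open>k\<close> is
  \<open>exp (\<i> (k\<^sub>y y + k\<^sub>z z))\<close> times a function of \<open>x\<close>.\<close>

definition lam :: "real \<Rightarrow> real \<times> real \<Rightarrow> complex" where
  "lam \<omega>t k = (if norm k \<ge> \<omega>t then of_real (sqrt ((norm k)\<^sup>2 - \<omega>t\<^sup>2))
               else \<i> * of_real (sqrt (\<omega>t\<^sup>2 - (norm k)\<^sup>2)))"

definition plane_wave :: "real \<times> real \<Rightarrow> complex^2 \<Rightarrow> real \<times> real \<Rightarrow> complex^2" where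
  "plane_wave k v = (\<lambda>\<eta>. cis (k \<bullet> \<eta>) *s v)"

type_synonym trace_op = "(real \<times> real \<Rightarrow> complex^2) \<Rightarrow> (real \<times> real \<Rightarrow> complex^2)"

text \<open>The operator \<open>S\<close> has the Fourier symbol \<open>\<sigma>\<close>, which is defined at the frequencies in \<open>K\<close>.\<close>

definition has_fourier_symbol ::
  "trace_op \<Rightarrow> (real \<times> real) set \<Rightarrow> (real \<times> real \<Rightarrow> complex^2^2) \<Rightarrow> bool" where
  "has_fourier_symbol S K \<sigma> \<longleftrightarrow>
     (\<forall>k\<in>K. \<forall>v. S (plane_wave k v) = plane_wave k (\<sigma> k *v v))"

definition M :: "real \<times> real \<Rightarrow> complex^2^2" where
  "M = (\<lambda>(ky, kz). vector
     [vector [of_real (ky\<^sup>2 - kz\<^sup>2), of_real (- 2 * ky * kz)],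
      vector [of_real (- 2 * ky * kz), of_real (kz\<^sup>2 - ky\<^sup>2)]])"

definition scale_mat :: "complex \<Rightarrow> complex^2^2 \<Rightarrow> complex^2^2" where
  "scale_mat c A = (\<chi> i j. c * A $ i $ j)"

text \<open>The field of rational functions in \<open>k\<^sub>z, k\<^sub>y\<close> is the fraction field of
  \<open>\<complex>[k\<^sub>y][k\<^sub>z]\<close>; the outer polynomial variable is \<open>k\<^sub>z\<close>. A rational function is defined at \<open>k\<close>
  if it can be written with a denominator that does not vanish there.\<close>

type_synonym ratfun = "complex poly poly fract"

definition poly2 :: "complex poly poly \<Rightarrow> real \<times> real \<Rightarrow> complex" where
  "poly2 p = (\<lambda>(ky, kz). poly (poly p [:of_real kz:]) (of_real ky))"

definition rat_dom :: "ratfun \<Rightarrow> (real \<times> real) set" where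
  "rat_dom f = {k. \<exists>p q. f = Fract p q \<and> poly2 q k \<noteq> 0}"

definition rat_at :: "ratfun \<Rightarrow> real \<times> real \<Rightarrow> complex" where
  "rat_at f k = (THE v. \<exists>p q. f = Fract p q \<and> poly2 q k \<noteq> 0 \<and> v = poly2 p k / poly2 q k)"


section \<open>Admissible homogeneous solutions\<close>

text \<open>Fields on \<open>\<Omega>\<close> are represented by functions on the whole space that vanish outside the
  closure of \<open>\<Omega>\<close> and are continuous on that closure, so that boundary traces are values and
  distinct functions are distinct fields. The last clause restricts to the single Fourier mode
  \<open>k\<close> and encodes the radiation condition: the dependence on \<open>x\<close> is a multiple of
  \<open>exp (s x)\<close>.\<close>

definition mode_field :: "real \<times> real \<Rightarrow> complex \<Rightarrow> (real^3) set \<Rightarrow> vfield \<Rightarrow> bool" where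
  "mode_field k s \<Omega> F \<longleftrightarrow>
     (\<forall>p. p \<notin> closure \<Omega> \<longrightarrow> F p = 0) \<and> continuous_on (closure \<Omega>) F \<and>
     (\<exists>c. \<forall>p\<in>\<Omega>. F p = (cis (k \<bullet> (p $ 2, p $ 3)) * exp (s * of_real (p $ 1))) *s c)"

definition admissible ::
  "real \<Rightarrow> real \<Rightarrow> real \<Rightarrow> real \<times> real \<Rightarrow> complex \<Rightarrow> (real^3) set \<Rightarrow> em_field set" where
  "admissible \<epsilon> \<mu> \<omega> k s \<Omega> =
     {(E, H). mode_field k s \<Omega> E \<and> mode_field k s \<Omega> H \<and> maxwell \<epsilon> \<mu> \<omega> (\<lambda>_. 0) \<Omega> (E, H)}"

definition V1 :: "real \<Rightarrow> real \<Rightarrow> real \<Rightarrow> real \<Rightarrow> real \<times> real \<Rightarrow> em_field set" where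
  "V1 \<epsilon> \<mu> \<omega> L k = admissible \<epsilon> \<mu> \<omega> k (lam (\<omega> * sqrt (\<epsilon> * \<mu>)) k) (Omega1 L)"

definition V2 :: "real \<Rightarrow> real \<Rightarrow> real \<Rightarrow> real \<times> real \<Rightarrow> em_field set" where
  "V2 \<epsilon> \<mu> \<omega> k = admissible \<epsilon> \<mu> \<omega> k (- lam (\<omega> * sqrt (\<epsilon> * \<mu>)) k) Omega2"


section \<open>Transmission conditions and the Schwarz iteration\<close>

text \<open>Characteristic variables in the \<open>x\<close> direction, as functions of \<open>(y, z)\<close> on the plane
  \<open>x = a\<close>.\<close>

definition w_minus :: "real \<Rightarrow> real \<Rightarrow> em_field \<Rightarrow> real \<times> real \<Rightarrow> complex^2" where
  "w_minus Z a = (\<lambda>(E, H) (y, z). let p = vector [a, y, z] in vector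
     [- (1/2) * (1 / of_real Z * E p $ 2 - H p $ 3),
      1/2 * (1 / of_real Z * E p $ 3 + H p $ 2)])"

definition w_plus :: "real \<Rightarrow> real \<Rightarrow> em_field \<Rightarrow> real \<times> real \<Rightarrow> complex^2" where
  "w_plus Z a = (\<lambda>(E, H) (y, z). let p = vector [a, y, z] in vector
     [1/2 * (1 / of_real Z * E p $ 2 + H p $ 3),
      - (1/2) * (1 / of_real Z * E p $ 3 - H p $ 2)])"

definition transmission12 ::
  "real \<Rightarrow> real \<Rightarrow> trace_op \<Rightarrow> em_field \<Rightarrow> em_field \<Rightarrow> bool" where
  "transmission12 Z L S1 u1 u2 \<longleftrightarrow>
     (\<forall>\<eta>. w_minus Z L u1 \<eta> + S1 (w_plus Z L u1) \<eta> = w_minus Z L u2 \<eta> + S1 (w_plus Z L u2) \<eta>)"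

definition transmission21 ::
  "real \<Rightarrow> trace_op \<Rightarrow> em_field \<Rightarrow> em_field \<Rightarrow> bool" where
  "transmission21 Z S2 u2 u1 \<longleftrightarrow>
     (\<forall>\<eta>. w_plus Z 0 u2 \<eta> + S2 (w_minus Z 0 u2) \<eta> = w_plus Z 0 u1 \<eta> + S2 (w_minus Z 0 u1) \<eta>)"

text \<open>One subdomain solve of the error equations: the new field in one subdomain from the
  previous field in the other.\<close>

definition solve1 ::
  "real \<Rightarrow> real \<Rightarrow> real \<Rightarrow> real \<Rightarrow> trace_op \<Rightarrow> real \<times> real \<Rightarrow> em_field \<Rightarrow> em_field" where
  "solve1 \<epsilon> \<mu> \<omega> L S1 k u2 =
     (THE u1. u1 \<in> V1 \<epsilon> \<mu> \<omega> L k \<and> transmission12 (sqrt (\<mu> / \<epsilon>)) L S1 u1 u2)"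

definition solve2 ::
  "real \<Rightarrow> real \<Rightarrow> real \<Rightarrow> trace_op \<Rightarrow> real \<times> real \<Rightarrow> em_field \<Rightarrow> em_field" where
  "solve2 \<epsilon> \<mu> \<omega> S2 k u1 =
     (THE u2. u2 \<in> V2 \<epsilon> \<mu> \<omega> k \<and> transmission21 (sqrt (\<mu> / \<epsilon>)) S2 u2 u1)"

definition iteration_well_defined ::
  "real \<Rightarrow> real \<Rightarrow> real \<Rightarrow> real \<Rightarrow> trace_op \<Rightarrow> trace_op \<Rightarrow> real \<times> real \<Rightarrow> bool" where
  "iteration_well_defined \<epsilon> \<mu> \<omega> L S1 S2 k \<longleftrightarrow>
     (\<forall>u2 \<in> V2 \<epsilon> \<mu> \<omega> k. \<exists>!u1. u1 \<in> V1 \<epsilon> \<mu> \<omega> L k \<and> transmission12 (sqrt (\<mu> / \<epsilon>)) L S1 u1 u2) \<and>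
     (\<forall>u1 \<in> V1 \<epsilon> \<mu> \<omega> L k. \<exists>!u2. u2 \<in> V2 \<epsilon> \<mu> \<omega> k \<and> transmission21 (sqrt (\<mu> / \<epsilon>)) S2 u2 u1)"


section \<open>Convergence factor\<close>

text \<open>\<open>em_field\<close> as a complex vector space\<close>

definition em_scale :: "complex \<Rightarrow> em_field \<Rightarrow> em_field" where
  "em_scale c = (\<lambda>(E, H). (\<lambda>p. c *s E p, \<lambda>p. c *s H p))"

interpretation em: vector_space em_scale
proof
  fix a b :: complex and u v :: em_field
  show "em_scale a (u + v) = em_scale a u + em_scale a v"
    by (cases u, cases v) (simp add: em_scale_def plus_fun_def vector_add_ldistrib)
  show "em_scale (a + b) u = em_scale a u + em_scale b u"
    by (cases u) (simp add: em_scale_def plus_fun_def vector_sadd_rdistrib)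
  show "em_scale a (em_scale b u) = em_scale (a * b) u"
    by (cases u) (simp add: em_scale_def vector_smult_assoc)
  show "em_scale 1 u = u"
    by (cases u) (simp add: em_scale_def)
qed

definition em_linear_on :: "em_field set \<Rightarrow> (em_field \<Rightarrow> em_field) \<Rightarrow> bool" where
  "em_linear_on V T \<longleftrightarrow> T ` V \<subseteq> V \<and>
     (\<forall>u\<in>V. \<forall>v\<in>V. T (u + v) = T u + T v) \<and> (\<forall>c. \<forall>u\<in>V. T (em_scale c u) = em_scale c (T u))"

text \<open>Spectral radius of a linear map of a finite-dimensional space \<open>V\<close> to itself.\<close>

definition em_spectral_radius :: "em_field set \<Rightarrow> (em_field \<Rightarrow> em_field) \<Rightarrow> real" where
  "em_spectral_radius V T = Max (cmod ` {c. \<exists>u\<in>V. u \<noteq> 0 \<and> T u = em_scale c u})"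

definition two_step_factor :: "em_field set \<Rightarrow> (em_field \<Rightarrow> em_field) \<Rightarrow> real \<Rightarrow> bool" where
  "two_step_factor V T \<rho> \<longleftrightarrow>
     em.subspace V \<and> em.dim V = 2 \<and> em_linear_on V T \<and> \<rho> = sqrt (em_spectral_radius V T)"

text \<open>Both subdomains have to give the same value \<open>\<rho>\<close>.\<close>

definition has_convergence_factor ::
  "real \<Rightarrow> real \<Rightarrow> real \<Rightarrow> real \<Rightarrow> trace_op \<Rightarrow> trace_op \<Rightarrow> real \<times> real \<Rightarrow> real \<Rightarrow> bool" where
  "has_convergence_factor \<epsilon> \<mu> \<omega> L S1 S2 k \<rho> \<longleftrightarrow>
     iteration_well_defined \<epsilon> \<mu> \<omega> L S1 S2 k \<and>
     two_step_factor (V1 \<epsilon> \<mu> \<omega> L k) (solve1 \<epsilon> \<mu> \<omega> L S1 k \<circ> solve2 \<epsilon> \<mu> \<omega> S2 k) \<rho> \<and>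
     two_step_factor (V2 \<epsilon> \<mu> \<omega> k) (solve2 \<epsilon> \<mu> \<omega> S2 k \<circ> solve1 \<epsilon> \<mu> \<omega> L S1 k) \<rho>"

end

theory Submission
  imports Defs
begin

text \<open>
  Let \<open>t\<close> be the wave number, \<open>p = (s + \<i>t)\<^sup>2\<close> and \<open>q = (s - \<i>t)\<^sup>2\<close>. In the characteristic amplitudes
  \<open>a\<close> of \<open>w\<^sub>+\<close> and \<open>b\<close> of \<open>w\<^sub>-\<close> the Maxwell system for a mode \<open>exp (s x)\<close> is equivalent to
  \<open>p a = - M b\<close> and \<open>q b = - M a\<close>; since \<open>M\<^sup>2 = |k|\<^sup>4 = p q\<close> and \<open>p \<noteq> 0\<close>, the first equation implies the
  second. Changing the sign of \<open>s\<close> exchanges \<open>p\<close> and \<open>q\<close>. Hence the solutions in the first subdomain are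
  parametrised by \<open>b\<close>, those in the second by \<open>a\<close>, and this includes \<open>k = 0\<close>, where \<open>q = M = 0\<close>.
  With symbols \<open>\<theta>\<^sub>l M\<close> each transmission condition becomes a multiple of \<open>M\<close>, so two steps act as the
  scalar \<open>(q / p) \<Prod>\<^sub>l (1 - \<theta>\<^sub>l p) / (1 - \<theta>\<^sub>l q) exp (- 2 s L)\<close>. The symbols \<open>\<delta> M\<^sup>-\<^sup>1\<close> are the case
  \<open>\<theta> = \<delta> / (p q)\<close>.
\<close>

section \<open>Fields concentrated at one frequency\<close>

definition phase :: "real \<times> real \<Rightarrow> complex \<Rightarrow> real^3 \<Rightarrow> complex" where
  "phase k s p = cis (k \<bullet> (p $ 2, p $ 3)) * exp (s * of_real (p $ 1))"

text \<open>Cutting off outside the closure, not outside \<open>\<Omega>\<close> itself, keeps the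
  boundary values from which traces are read.\<close>

definition mode :: "real \<times> real \<Rightarrow> complex \<Rightarrow> (real^3) set \<Rightarrow> complex^3 \<Rightarrow> vfield" where
  "mode k s \<Omega> c p = (if p \<in> closure \<Omega> then phase k s p *s c else 0)"

lemma phase_nonzero [simp]: "phase k s p \<noteq> 0"
  by (simp add: phase_def)

lemma bounded_linear_scale_vec: "bounded_linear (\<lambda>z::complex. z *s (c :: complex^'n))"
  by (intro linear_conv_bounded_linear[THEN iffD1] linearI)
     (auto simp: vec_eq_iff algebra_simps)

lemma continuous_on_phase: "continuous_on A (phase k s)"
  unfolding phase_def cis_conv_exp by (intro continuous_intros)

text \<open>The exponent is a real-linear function of the position, hence its own derivative, and
  the chain rule with \<open>exp\<close> gives the factor.\<close>

lemma phase_has_derivative: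
  "(phase k s has_derivative
     (\<lambda>h. (\<i> * of_real (k \<bullet> (h $ 2, h $ 3)) + s * of_real (h $ 1)) * phase k s p)) (at p)"
proof -
  let ?g = "\<lambda>p::real^3. \<i> * of_real (k \<bullet> (p $ 2, p $ 3)) + s * of_real (p $ 1)"
  have "linear ?g"
    by (rule linearI) (auto simp: algebra_simps inner_prod_def scaleR_conv_of_real[where 'a=complex])
  then have "(?g has_derivative ?g) (at p)"
    by (simp add: linear_conv_bounded_linear bounded_linear_imp_has_derivative)
  from has_derivative_compose[OF this, of exp "(*) (exp (?g p))"]
  have "((\<lambda>p. exp (?g p)) has_derivative (\<lambda>h. exp (?g p) * ?g h)) (at p)"
    using DERIV_exp[of "?g p"] by (simp add: has_field_derivative_def)
  moreover have "phase k s = (\<lambda>p. exp (?g p))"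
    by (simp add: phase_def cis_conv_exp exp_add fun_eq_iff)
  ultimately show ?thesis
    by (simp add: mult.commute)
qed

lemma mode_has_derivative:
  assumes "open \<Omega>" "p \<in> \<Omega>"
  shows "(mode k s \<Omega> c has_derivative
     (\<lambda>h. ((\<i> * of_real (k \<bullet> (h $ 2, h $ 3)) + s * of_real (h $ 1)) * phase k s p) *s c)) (at p)"
proof (rule has_derivative_transform_within_open[OF _ assms])
  show "((\<lambda>p. phase k s p *s c) has_derivative
     (\<lambda>h. ((\<i> * of_real (k \<bullet> (h $ 2, h $ 3)) + s * of_real (h $ 1)) * phase k s p) *s c)) (at p)"
    by (rule bounded_linear.has_derivative[OF bounded_linear_scale_vec phase_has_derivative])
  show "phase k s x *s c = mode k s \<Omega> c x" if "x \<in> \<Omega>" for x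
    using that closure_subset by (auto simp: mode_def)
qed

text \<open>Fourier symbol of the curl: \<open>s\<close> replaces the x derivative, and
  \<open>\<i>\<close> times the components of \<open>k\<close> replace the y and z
  derivatives.\<close>

definition symbol_curl :: "real \<times> real \<Rightarrow> complex \<Rightarrow> complex^3 \<Rightarrow> complex^3" where
  "symbol_curl k s c = vector
     [\<i> * of_real (fst k) * c $ 3 - \<i> * of_real (snd k) * c $ 2,
      \<i> * of_real (snd k) * c $ 1 - s * c $ 3,
      s * c $ 2 - \<i> * of_real (fst k) * c $ 1]"

lemma curl_mode:
  assumes "open \<Omega>" "p \<in> \<Omega>"
  shows "curl (mode k s \<Omega> c) p = phase k s p *s symbol_curl k s c"
proof -
  have "partial i (mode k s \<Omega> c) p =
      ((\<i> * of_real (k \<bullet> (axis i 1 $ 2, axis i 1 $ 3)) + s * of_real (axis i 1 $ 1)) * phase k s p) *s c" for i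
    unfolding partial_def
    using frechet_derivative_at[OF mode_has_derivative[OF assms], symmetric] by simp
  then show ?thesis
    by (cases k) (simp add: curl_def symbol_curl_def vec_eq_iff forall_3 axis_def algebra_simps)
qed

text \<open>The exponential form is prescribed on \<open>\<Omega>\<close> alone; continuity carries
  it to the closure, where \<open>\<Omega>\<close> is dense.\<close>

lemma mode_field_iff: "mode_field k s \<Omega> F \<longleftrightarrow> (\<exists>c. F = mode k s \<Omega> c)"
proof
  assume F: "mode_field k s \<Omega> F"
  then obtain c where c: "\<And>p. p \<in> \<Omega> \<Longrightarrow> F p = phase k s p *s c"
    by (auto simp: mode_field_def phase_def)
  have "continuous_on (closure \<Omega>) (\<lambda>p. phase k s p *s c)"
    by (rule bounded_linear.continuous_on[OF bounded_linear_scale_vec continuous_on_phase])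
  then have "continuous_on (closure \<Omega>) (\<lambda>p. F p - phase k s p *s c)"
    using F by (intro continuous_intros) (auto simp: mode_field_def)
  then have "F p - phase k s p *s c = 0" if "p \<in> closure \<Omega>" for p
    by (rule continuous_constant_on_closure[OF _ _ that]) (simp add: c)
  then have "F = mode k s \<Omega> c"
    using F by (auto simp: mode_def mode_field_def)
  then show "\<exists>c. F = mode k s \<Omega> c" ..
next
  assume "\<exists>c. F = mode k s \<Omega> c"
  then obtain c where c: "F = mode k s \<Omega> c" ..
  have "continuous_on (closure \<Omega>) (\<lambda>p. phase k s p *s c)"
    by (rule bounded_linear.continuous_on[OF bounded_linear_scale_vec continuous_on_phase])
  then have "continuous_on (closure \<Omega>) F"
    by (rule continuous_on_eq) (simp add: c mode_def)
  then show "mode_field k s \<Omega> F"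
    using closure_subset by (fastforce simp: mode_field_def c mode_def phase_def)
qed

text \<open>The curl acts by its symbol, and the common phase never vanishes, so it cancels. One
  point of \<open>\<Omega>\<close> recovers the algebraic system, which is why
  \<open>\<Omega>\<close> must be nonempty.\<close>

lemma admissible_iff:
  assumes "open \<Omega>" "\<Omega> \<noteq> {}"
  shows "(E, H) \<in> admissible \<epsilon> \<mu> \<omega> k s \<Omega> \<longleftrightarrow>
    (\<exists>e h. E = mode k s \<Omega> e \<and> H = mode k s \<Omega> h \<and>
       symbol_curl k s h = (\<i> * of_real (\<omega> * \<epsilon>)) *s e \<and>
       symbol_curl k s e = - ((\<i> * of_real (\<omega> * \<mu>)) *s h))"
proof -
  have "maxwell \<epsilon> \<mu> \<omega> (\<lambda>_. 0) \<Omega> (mode k s \<Omega> e, mode k s \<Omega> h) \<longleftrightarrow>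
       symbol_curl k s h = (\<i> * of_real (\<omega> * \<epsilon>)) *s e \<and>
       symbol_curl k s e = - ((\<i> * of_real (\<omega> * \<mu>)) *s h)" (is "_ \<longleftrightarrow> ?R") for e h
  proof -
    have "mode k s \<Omega> c differentiable (at p)" if "p \<in> \<Omega>" for c p
      using mode_has_derivative[OF assms(1) that] unfolding differentiable_def by blast
    moreover have "- (\<i> * of_real (\<omega> * \<epsilon>)) *s mode k s \<Omega> e p + curl (mode k s \<Omega> h) p = 0 \<and>
        (\<i> * of_real (\<omega> * \<mu>)) *s mode k s \<Omega> h p + curl (mode k s \<Omega> e) p = 0 \<longleftrightarrow> ?R"
      if "p \<in> \<Omega>" for p
    proof -
      have "- (\<i> * of_real (\<omega> * \<epsilon>)) *s mode k s \<Omega> e p + curl (mode k s \<Omega> h) p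
           = phase k s p *s (symbol_curl k s h - (\<i> * of_real (\<omega> * \<epsilon>)) *s e)"
        and "(\<i> * of_real (\<omega> * \<mu>)) *s mode k s \<Omega> h p + curl (mode k s \<Omega> e) p
           = phase k s p *s (symbol_curl k s e + (\<i> * of_real (\<omega> * \<mu>)) *s h)"
        using that closure_subset
        by (auto simp: curl_mode[OF assms(1)] mode_def vec_eq_iff algebra_simps)
      then show ?thesis
        by (simp only: vector_mul_eq_0 phase_nonzero simp_thms right_minus_eq
              eq_neg_iff_add_eq_0)
    qed
    ultimately show ?thesis
      using assms(2) by (auto simp: maxwell_def)
  qed
  then show ?thesis
    by (auto simp: admissible_def mode_field_iff)
qed

section \<open>The Maxwell system in characteristic amplitudes\<close>

text \<open>The normal components are forced by the \<open>x\<close> components of the two curl equations.\<close>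

definition char_E :: "real \<Rightarrow> real \<Rightarrow> real \<times> real \<Rightarrow> complex^2 \<Rightarrow> complex^2 \<Rightarrow> complex^3" where
  "char_E Z t k a b = of_real Z *s vector
     [(of_real (fst k) * (a$1 + b$1) - of_real (snd k) * (a$2 + b$2)) / of_real t,
      a$1 - b$1, b$2 - a$2]"

definition char_H :: "real \<Rightarrow> real \<times> real \<Rightarrow> complex^2 \<Rightarrow> complex^2 \<Rightarrow> complex^3" where
  "char_H t k a b = vector
     [(of_real (snd k) * (a$1 - b$1) + of_real (fst k) * (a$2 - b$2)) / of_real t,
      a$2 + b$2, a$1 + b$1]"

lemma M_mult_vec:
  "M k *v v = vector
     [of_real ((fst k)\<^sup>2 - (snd k)\<^sup>2) * v$1 - of_real (2 * fst k * snd k) * v$2,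
      - of_real (2 * fst k * snd k) * v$1 + of_real ((snd k)\<^sup>2 - (fst k)\<^sup>2) * v$2]"
  by (cases k) (simp add: M_def vec_eq_iff forall_2 matrix_vector_mult_def sum_2)

lemma norm_pair_power2: "(norm (k :: real \<times> real))\<^sup>2 = (fst k)\<^sup>2 + (snd k)\<^sup>2"
  by (simp add: norm_prod_def)

text \<open>The x components hold identically by the choice of normal components. The four
  tangential equations have residuals \<open>H2\<close>, \<open>H3\<close>, \<open>E2\<close>,
  \<open>E3\<close>, and the components of the relations on the right are invertible combinations of
  these.\<close>

lemma symbol_maxwell_char_iff:
  assumes Z: "Z > 0" and t: "t > 0" and s: "s\<^sup>2 = of_real ((norm k)\<^sup>2 - t\<^sup>2)"
  shows "symbol_curl k s (char_H t k a b) = (\<i> * of_real (t / Z)) *s char_E Z t k a b \<and>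
         symbol_curl k s (char_E Z t k a b) = - ((\<i> * of_real (t * Z)) *s char_H t k a b) \<longleftrightarrow>
         (s + \<i> * of_real t)\<^sup>2 *s a = - (M k *v b) \<and> (s - \<i> * of_real t)\<^sup>2 *s b = - (M k *v a)"
    (is "?maxwell \<longleftrightarrow> ?rel")
proof -
  define T y z where "T = complex_of_real t" and "y = complex_of_real (fst k)"
    and "z = complex_of_real (snd k)"
  have T0: "T \<noteq> 0"
    using t by (simp add: T_def)
  have ss: "s\<^sup>2 = y\<^sup>2 + z\<^sup>2 - T\<^sup>2"
    by (simp add: s norm_pair_power2 T_def y_def z_def)
  \<comment> \<open>These are the normal components of the electric field divided by
    \<open>Z\<close> and of the magnetic field.\<close>
  define u v where "u = (y * (a$1 + b$1) - z * (a$2 + b$2)) / T"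
    and "v = (z * (a$1 - b$1) + y * (a$2 - b$2)) / T"
  have uv: "T * u = y * (a$1 + b$1) - z * (a$2 + b$2)"
           "T * v = z * (a$1 - b$1) + y * (a$2 - b$2)"
    using T0 by (simp_all add: u_def v_def)
  have iuv: "\<i> * (y * (a$1 + b$1)) - \<i> * (z * (a$2 + b$2)) = \<i> * (T * u)"
           "\<i> * (y * (b$2 - a$2)) - \<i> * (z * (a$1 - b$1)) = - (\<i> * (T * v))"
    unfolding uv by (simp_all add: algebra_simps)
  define H2 H3 E2 E3 where "H2 = \<i> * z * v - s * (a$1 + b$1) - \<i> * T * (a$1 - b$1)"
    and "H3 = s * (a$2 + b$2) - \<i> * y * v - \<i> * T * (b$2 - a$2)"
    and "E2 = \<i> * z * u - s * (b$2 - a$2) + \<i> * T * (a$2 + b$2)"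
    and "E3 = s * (a$1 - b$1) - \<i> * y * u + \<i> * T * (a$1 + b$1)"
  have "symbol_curl k s (char_H t k a b) = (\<i> * of_real (t / Z)) *s char_E Z t k a b
      \<longleftrightarrow> H2 = 0 \<and> H3 = 0"
    using Z T0 iuv
    by (simp add: vec_eq_iff forall_3 symbol_curl_def char_E_def char_H_def H2_def H3_def
        flip: T_def y_def z_def u_def v_def) (auto simp: algebra_simps)
  \<comment> \<open>The electric amplitude is proportional to \<open>Z\<close>, so a factor
    \<open>Z\<close> cancels and the case \<open>Z = 1\<close> remains.\<close>
  moreover have "symbol_curl k s (char_E Z t k a b) =
        of_real Z *s (symbol_curl k s (char_E 1 t k a b))"
    by (simp add: vec_eq_iff forall_3 symbol_curl_def char_E_def algebra_simps)
  then have "symbol_curl k s (char_E Z t k a b) = - ((\<i> * of_real (t * Z)) *s char_H t k a b)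
      \<longleftrightarrow> of_real Z *s (symbol_curl k s (char_E 1 t k a b)) = of_real Z *s (- ((\<i> * T) *s char_H t k a b))"
    by (simp add: T_def vec_eq_iff mult_ac)
  then have "symbol_curl k s (char_E Z t k a b) = - ((\<i> * of_real (t * Z)) *s char_H t k a b)
      \<longleftrightarrow> symbol_curl k s (char_E 1 t k a b) = - ((\<i> * T) *s char_H t k a b)"
    using Z unfolding vector_mul_lcancel by simp
  moreover have "symbol_curl k s (char_E 1 t k a b) = - ((\<i> * T) *s char_H t k a b)
      \<longleftrightarrow> E2 = 0 \<and> E3 = 0"
    using T0 iuv
    by (simp add: vec_eq_iff forall_3 symbol_curl_def char_E_def char_H_def E2_def E3_def
        flip: T_def y_def z_def u_def v_def) (auto simp: algebra_simps eq_neg_iff_add_eq_0)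
  ultimately have 1: "?maxwell \<longleftrightarrow> (H2 = 0 \<and> H3 = 0) \<and> E2 = 0 \<and> E3 = 0"
    by blast
  \<comment> \<open>After multiplication by \<open>T\<close> the normal components occur only as
    \<open>T * u\<close> and \<open>T * v\<close>, which \<open>uv\<close> makes polynomial in the
    amplitudes.\<close>
  have TH: "T * H2 = \<i> * z * (T * v) - s * T * (a$1 + b$1) - \<i> * T\<^sup>2 * (a$1 - b$1)"
    "T * H3 = s * T * (a$2 + b$2) - \<i> * y * (T * v) - \<i> * T\<^sup>2 * (b$2 - a$2)"
    "T * E2 = \<i> * z * (T * u) - s * T * (b$2 - a$2) + \<i> * T\<^sup>2 * (a$2 + b$2)"
    "T * E3 = s * T * (a$1 - b$1) - \<i> * y * (T * u) + \<i> * T\<^sup>2 * (a$1 + b$1)"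
    by (simp_all add: H2_def H3_def E2_def E3_def algebra_simps power2_eq_square)
  \<comment> \<open>The dispersion relation enters here, eliminating the square of
    \<open>s\<close>.\<close>
  have sq: "(s + \<i> * T)\<^sup>2 = y\<^sup>2 + z\<^sup>2 - 2 * T\<^sup>2 + 2 * \<i> * s * T"
    "(s - \<i> * T)\<^sup>2 = y\<^sup>2 + z\<^sup>2 - 2 * T\<^sup>2 - 2 * \<i> * s * T"
    by (simp_all add: power2_sum power2_diff ss power_mult_distrib)
  have 2: "((s + \<i> * T)\<^sup>2 *s a + M k *v b) $ 1 = \<i> * (T * E3 - T * H2)"
    "((s - \<i> * T)\<^sup>2 *s b + M k *v a) $ 1 = \<i> * (T * E3 + T * H2)"
    "((s + \<i> * T)\<^sup>2 *s a + M k *v b) $ 2 = \<i> * (T * E2 + T * H3)"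
    "((s - \<i> * T)\<^sup>2 *s b + M k *v a) $ 2 = \<i> * (T * E2 - T * H3)"
    unfolding sq M_mult_vec TH uv
    by (simp_all add: algebra_simps power2_eq_square flip: y_def z_def)
  have "?rel \<longleftrightarrow> (s + \<i> * T)\<^sup>2 *s a + M k *v b = 0 \<and> (s - \<i> * T)\<^sup>2 *s b + M k *v a = 0"
    by (simp add: T_def eq_neg_iff_add_eq_0)
  also have "\<dots> \<longleftrightarrow> E3 - H2 = 0 \<and> E2 + H3 = 0 \<and> E3 + H2 = 0 \<and> E2 - H3 = 0"
    unfolding vec_eq_iff forall_2 2 using T0 by (auto simp flip: right_diff_distrib distrib_left)
  also have "\<dots> \<longleftrightarrow> (H2 = 0 \<and> H3 = 0) \<and> E2 = 0 \<and> E3 = 0"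
    by (auto simp: eq_neg_iff_add_eq_0[symmetric])
  finally show ?thesis
    using 1 by simp
qed

text \<open>Inverting the characteristic decomposition reads \<open>a\<close> and \<open>b\<close>
  off the tangential components of any solution; it remains to recover its normal
  components.\<close>

lemma symbol_maxwell_iff:
  assumes Z: "Z > 0" and t: "t > 0" and s: "s\<^sup>2 = of_real ((norm k)\<^sup>2 - t\<^sup>2)"
  shows "symbol_curl k s h = (\<i> * of_real (t / Z)) *s e \<and>
         symbol_curl k s e = - ((\<i> * of_real (t * Z)) *s h) \<longleftrightarrow>
         (\<exists>a b. e = char_E Z t k a b \<and> h = char_H t k a b \<and>
            (s + \<i> * of_real t)\<^sup>2 *s a = - (M k *v b) \<and> (s - \<i> * of_real t)\<^sup>2 *s b = - (M k *v a))"
    (is "?maxwell \<longleftrightarrow> _")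
proof -
  have "e = char_E Z t k a b \<and> h = char_H t k a b"
    if maxwell: ?maxwell
    and ab: "a = vector [(h$3 + e$2 / of_real Z) / 2, (h$2 - e$3 / of_real Z) / 2]"
      "b = vector [(h$3 - e$2 / of_real Z) / 2, (h$2 + e$3 / of_real Z) / 2]" for a b
  proof -
    have "a$1 + b$1 = h$3" "a$2 + b$2 = h$2"
      "a$1 - b$1 = e$2 / of_real Z" "b$2 - a$2 = e$3 / of_real Z"
      by (simp_all add: ab field_simps)
    note ab' = this
    have ab'': "a$2 - b$2 = - (e$3 / of_real Z)"
      using ab'(4) by (metis minus_diff_eq)
    \<comment> \<open>The x components of the two curl equations determine \<open>e$1\<close> and
      \<open>h$1\<close>.\<close>
    have "\<i> * (of_real (fst k) * h$3 - of_real (snd k) * h$2) = \<i> * (of_real (t / Z) * e$1)"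
      "\<i> * (of_real (fst k) * e$3 - of_real (snd k) * e$2) = \<i> * (- (of_real (t * Z) * h$1))"
      using maxwell by (auto simp: vec_eq_iff forall_3 symbol_curl_def algebra_simps)
    then have "of_real (fst k) * h$3 - of_real (snd k) * h$2 = of_real (t / Z) * e$1"
      "of_real (fst k) * e$3 - of_real (snd k) * e$2 = - (of_real (t * Z) * h$1)"
      by (simp_all only: mult_cancel_left) auto
    then show ?thesis
      using Z t unfolding char_E_def char_H_def ab' ab''
      by (simp add: vec_eq_iff forall_3 field_simps)
  qed
  then show ?thesis
    using symbol_maxwell_char_iff[OF assms] by metis
qed

definition char_wave ::
  "real \<Rightarrow> real \<Rightarrow> real \<times> real \<Rightarrow> complex \<Rightarrow> (real^3) set \<Rightarrow> complex^2 \<Rightarrow> complex^2 \<Rightarrow> em_field" where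
  "char_wave Z t k s \<Omega> a b = (mode k s \<Omega> (char_E Z t k a b), mode k s \<Omega> (char_H t k a b))"

lemma char_wave_add:
  "char_wave Z t k s \<Omega> (a + a') (b + b') = char_wave Z t k s \<Omega> a b + char_wave Z t k s \<Omega> a' b'"
  by (auto simp: char_wave_def mode_def char_E_def char_H_def fun_eq_iff vec_eq_iff forall_3
      algebra_simps add_divide_distrib diff_divide_distrib)

lemma char_wave_scale:
  "char_wave Z t k s \<Omega> (c *s a) (c *s b) = em_scale c (char_wave Z t k s \<Omega> a b)"
  by (auto simp: char_wave_def em_scale_def mode_def char_E_def char_H_def fun_eq_iff vec_eq_iff
      forall_3 algebra_simps add_divide_distrib diff_divide_distrib)

text \<open>This identifies \<open>a\<close> and \<open>b\<close> as the amplitudes of the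
  characteristic variables. The closure hypothesis keeps the plane out of the region where the field
  is cut off.\<close>

lemma w_char_wave:
  assumes "Z > 0" and "\<And>y z. vector [x, y, z] \<in> closure \<Omega>"
  shows "w_plus Z x (char_wave Z t k s \<Omega> a b) = plane_wave k (exp (s * of_real x) *s a)"
    and "w_minus Z x (char_wave Z t k s \<Omega> a b) = plane_wave k (exp (s * of_real x) *s b)"
  using assms
  by (auto simp: w_plus_def w_minus_def char_wave_def mode_def plane_wave_def phase_def
      char_E_def char_H_def fun_eq_iff vec_eq_iff forall_2 field_simps)

section \<open>Algebra of plane waves, of \<open>M\<close> and of scalar maps\<close>

lemma plane_wave_eq_iff: "plane_wave k v \<eta> = plane_wave k w \<eta> \<longleftrightarrow> v = w"
  by (simp add: plane_wave_def vector_mul_lcancel)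

lemma plane_wave_add: "plane_wave k v \<eta> + plane_wave k w \<eta> = plane_wave k (v + w) \<eta>"
  by (simp add: plane_wave_def vector_add_ldistrib)

text \<open>For nonzero \<open>k\<close>, the symmetric trace-free matrix \<open>M k\<close> is the
  squared length of \<open>k\<close> times a reflection.\<close>

lemma M_mult_M: "M k *v (M k *v v) = of_real ((norm k) ^ 4) *s v"
proof -
  have "(norm k) ^ 4 = ((fst k)\<^sup>2 + (snd k)\<^sup>2)\<^sup>2"
    by (simp flip: norm_pair_power2 power_mult)
  then show ?thesis
    by (simp add: M_mult_vec vec_eq_iff forall_2 algebra_simps power2_eq_square)
qed

lemma M_mult_scale: "M k *v (c *s v) = c *s (M k *v v)"
  by (simp add: vec.scale)

text \<open>\<open>G\<close> transports the two-dimensional space of amplitudes isomorphically onto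
  its range, where \<open>T\<close> is a scalar; that scalar is its only eigenvalue.\<close>

lemma two_step_factor_scalar:
  fixes G :: "complex^2 \<Rightarrow> em_field"
  assumes add: "\<And>v w. G (v + w) = G v + G w" and scale: "\<And>c v. G (c *s v) = em_scale c (G v)"
    and inj: "inj G" and T: "\<And>v. T (G v) = em_scale c (G v)"
  shows "two_step_factor (range G) T (sqrt (cmod c))"
proof -
  have zero: "G 0 = 0"
    using scale[of 0 0] by (simp add: em.scale_zero_left)
  have sub: "em.subspace (range G)"
    by (rule em.subspaceI) (auto simp flip: zero add scale)
  let ?e1 = "axis 1 1 :: complex^2" and ?e2 = "axis 2 1 :: complex^2"
  have G: "G v = em_scale (v$1) (G ?e1) + em_scale (v$2) (G ?e2)" for v
  proof -
    have "v = v$1 *s ?e1 + v$2 *s ?e2"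
      by (simp add: vec_eq_iff forall_2 axis_def)
    then have "G v = G (v$1 *s ?e1 + v$2 *s ?e2)"
      by (rule arg_cong)
    then show ?thesis
      by (simp only: scale add)
  qed
  have "em.span {G ?e2, G ?e1} = range G"
  proof
    show "em.span {G ?e2, G ?e1} \<subseteq> range G"
      by (rule em.span_minimal[OF _ sub]) auto
    show "range G \<subseteq> em.span {G ?e2, G ?e1}"
    proof
      fix u assume "u \<in> range G"
      then obtain v where "u = G v" by blast
      then show "u \<in> em.span {G ?e2, G ?e1}"
        by (simp add: G[of v] em.span_add em.span_scale em.span_base)
    qed
  qed
  moreover have ne: "G ?e1 \<noteq> 0" "G ?e2 \<notin> em.span {G ?e1}"
  proof -
    show "G ?e1 \<noteq> 0"
      using injD[OF inj, of ?e1 0] zero by (auto simp: axis_eq_0_iff)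
    have "G ?e2 \<noteq> em_scale d (G ?e1)" for d
      using injD[OF inj, of ?e2 "d *s ?e1"] scale by (auto simp: vec_eq_iff forall_2 axis_def)
    then show "G ?e2 \<notin> em.span {G ?e1}"
      by (auto simp: em.span_singleton)
  qed
  moreover have "em.independent {G ?e2, G ?e1}"
    using ne by (simp add: em.independent_insert em.dependent_single)
  moreover have "G ?e1 \<noteq> G ?e2"
    using ne(2) em.span_base[of "G ?e1" "{G ?e1}"] by auto
  ultimately have "em.dim (range G) = 2"
    using em.dim_eq_card[of "{G ?e2, G ?e1}" "range G"] em.span_eq_iff[THEN iffD2, OF sub] by simp
  moreover have "em_linear_on (range G) T"
  proof -
    have "T (G v) \<in> range G" for v
      unfolding T scale[symmetric] by (rule rangeI)
    moreover have "T (G v + G w) = T (G v) + T (G w)" for v w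
      unfolding add[symmetric] T by (simp only: add em.scale_right_distrib)
    moreover have "T (em_scale d (G v)) = em_scale d (T (G v))" for d v
      unfolding scale[symmetric] T by (simp only: vector_smult_assoc mult.commute)
    ultimately show ?thesis
      unfolding em_linear_on_def by blast
  qed
  \<comment> \<open>A nonzero vector in the range is needed for \<open>c\<close> to be attained as
    an eigenvalue.\<close>
  moreover have "{d. \<exists>u\<in>range G. u \<noteq> 0 \<and> T u = em_scale d u} = {c}"
    using ne(1) by (auto simp: T em.scale_cancel_right)
  then have "em_spectral_radius (range G) T = cmod c"
    by (simp add: em_spectral_radius_def)
  ultimately show ?thesis
    using sub by (simp add: two_step_factor_def)
qed

text \<open>Here \<open>v\<close> is the new amplitude, \<open>w\<close> the old one, and
  \<open>x\<close>, \<open>y\<close> are their exponential factors on the interface. On the left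
  \<open>M\<close> occurs twice and collapses to a scalar, while on the right it occurs
  once.\<close>

lemma interface_eq_iff:
  assumes pq: "p * q = of_real ((norm k) ^ 4)" and "p \<noteq> 0" "x \<noteq> 0" "1 - \<theta> * q \<noteq> 0"
  shows "x *s v + \<theta> *s (M k *v (x *s ((- 1 / p) *s (M k *v v)))) =
         y *s ((- 1 / p) *s (M k *v w)) + \<theta> *s (M k *v (y *s w)) \<longleftrightarrow>
         v = (- (y / x) * (1 - \<theta> * p) / (p * (1 - \<theta> * q))) *s (M k *v w)"
proof -
  have "x *s v + \<theta> *s (M k *v (x *s ((- 1 / p) *s (M k *v v)))) = (x * (1 - \<theta> * q)) *s v"
    using \<open>p \<noteq> 0\<close> unfolding M_mult_scale M_mult_M pq[symmetric]
    by (simp add: vec_eq_iff field_simps)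
  moreover have "y *s ((- 1 / p) *s (M k *v w)) + \<theta> *s (M k *v (y *s w)) =
      (- y * (1 - \<theta> * p) / p) *s (M k *v w)"
    using \<open>p \<noteq> 0\<close> unfolding M_mult_scale by (simp add: vec_eq_iff field_simps)
  moreover have "(x * (1 - \<theta> * q)) *s v = (- y * (1 - \<theta> * p) / p) *s (M k *v w) \<longleftrightarrow>
      v = (- (y / x) * (1 - \<theta> * p) / (p * (1 - \<theta> * q))) *s (M k *v w)"
    using assms(2-) by (auto simp: vec_eq_iff field_simps)
  ultimately show ?thesis
    by simp
qed

lemma char_relation_iff:
  assumes "p * q = of_real ((norm k) ^ 4)" "p \<noteq> 0"
  shows "p *s a = - (M k *v b) \<and> q *s b = - (M k *v a) \<longleftrightarrow> a = (- 1 / p) *s (M k *v b)"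
proof -
  have "p *s a = - (M k *v b) \<longleftrightarrow> a = (- 1 / p) *s (M k *v b)"
    using assms(2) by (auto simp: vec_eq_iff field_simps)
  moreover have "q *s b = - (M k *v ((- 1 / p) *s (M k *v b)))"
    unfolding M_mult_scale M_mult_M assms(1)[symmetric]
    using assms(2) by (simp add: vec_eq_iff)
  ultimately show ?thesis by metis
qed

text \<open>\<open>matrix_inv\<close> is defined by choice, so uniqueness of two-sided inverses is
  what gives its value.\<close>

lemma matrix_inv_unique:
  fixes A B :: "'a::semiring_1^'n^'n"
  assumes "A ** B = mat 1" "B ** A = mat 1"
  shows "matrix_inv A = B"
  unfolding matrix_inv_def
proof (rule some_equality)
  fix C assume "A ** C = mat 1 \<and> C ** A = mat 1"
  then have "C = C ** (A ** B)" "C ** A = mat 1"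
    by (simp_all add: assms)
  then show "C = B"
    by (simp add: matrix_mul_assoc)
qed (use assms in blast)

lemma scale_mat_mult_vec: "scale_mat c A *v v = c *s (A *v v)"
  by (simp add: scale_mat_def vec_eq_iff matrix_vector_mult_def sum_distrib_left mult.assoc)

section \<open>Interface solves\<close>

lemma closure_Omega1: "closure (Omega1 L) = {p. p $ 1 \<le> L}"
  by (simp add: Omega1_def)

lemma closure_Omega2: "closure Omega2 = {p. 0 \<le> p $ 1}"
  using closure_halfspace_component_gt[of 0 1] by (simp add: Omega2_def)

lemma Omega_open_nonempty:
  "open (Omega1 L)" "Omega1 L \<noteq> {}" "open Omega2" "Omega2 \<noteq> {}"
proof -
  show "open (Omega1 L)" "open Omega2"
    unfolding Omega1_def Omega2_def
    by (rule open_halfspace_component_lt_cart open_halfspace_component_gt_cart)+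
  have "vec (L - 1) \<in> Omega1 L" "vec 1 \<in> Omega2"
    by (simp_all add: Omega1_def Omega2_def)
  then show "Omega1 L \<noteq> {}" "Omega2 \<noteq> {}"
    by blast+
qed

lemma admissible_eq_range:
  assumes pos: "\<epsilon> > 0" "\<mu> > 0" "\<omega> > 0" and \<Omega>: "open \<Omega>" "\<Omega> \<noteq> {}"
    and Z: "Z = sqrt (\<mu> / \<epsilon>)" and t: "t = \<omega> * sqrt (\<epsilon> * \<mu>)"
    and s: "s\<^sup>2 = of_real ((norm k)\<^sup>2 - t\<^sup>2)"
  shows "admissible \<epsilon> \<mu> \<omega> k s \<Omega> = {char_wave Z t k s \<Omega> a b |a b.
    (s + \<i> * of_real t)\<^sup>2 *s a = - (M k *v b) \<and> (s - \<i> * of_real t)\<^sup>2 *s b = - (M k *v a)}"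
proof -
  have Z0: "Z > 0" and t0: "t > 0"
    using pos by (simp_all add: Z t)
  \<comment> \<open>The material constants enter the equations only through the wave number and the
    impedance.\<close>
  have "\<omega> * \<epsilon> = t / Z" "\<omega> * \<mu> = t * Z"
    using pos by (simp_all add: Z t real_sqrt_mult real_sqrt_divide)
  then have "(E, H) \<in> admissible \<epsilon> \<mu> \<omega> k s \<Omega> \<longleftrightarrow> (\<exists>a b. (E, H) = char_wave Z t k s \<Omega> a b \<and>
    (s + \<i> * of_real t)\<^sup>2 *s a = - (M k *v b) \<and> (s - \<i> * of_real t)\<^sup>2 *s b = - (M k *v a))" for E H
    unfolding admissible_iff[OF \<Omega>] char_wave_def prod.inject
    by (simp only: symbol_maxwell_iff[OF Z0 t0 s]) blast
  then show ?thesis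
    by auto
qed

section \<open>The iteration on one Fourier mode\<close>

locale schwarz_mode =
  fixes \<epsilon> \<mu> \<omega> L :: real and k :: "real \<times> real"
  assumes pos: "\<epsilon> > 0" "\<mu> > 0" "\<omega> > 0" "L \<ge> 0"
begin

definition "t = \<omega> * sqrt (\<epsilon> * \<mu>)"
definition "Z = sqrt (\<mu> / \<epsilon>)"
definition "s = lam t k"
definition "p = (s + \<i> * of_real t)\<^sup>2"
definition "q = (s - \<i> * of_real t)\<^sup>2"

lemma t_pos: "t > 0" and Z_pos: "Z > 0"
  using pos by (simp_all add: t_def Z_def)

lemma s_power2: "s\<^sup>2 = of_real ((norm k)\<^sup>2 - t\<^sup>2)"
proof (cases "norm k \<ge> t")
  case True
  then show ?thesis
    using t_pos by (simp add: s_def lam_def flip: of_real_power)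
next
  case False
  then have "(norm k)\<^sup>2 \<le> t\<^sup>2"
    by (intro power_mono) auto
  with False show ?thesis
    by (simp add: s_def lam_def power_mult_distrib flip: of_real_power)
qed

lemma p_mult_q: "p * q = of_real ((norm k) ^ 4)"
proof -
  have "(s + \<i> * of_real t) * (s - \<i> * of_real t) = s\<^sup>2 + (of_real t)\<^sup>2"
    by (simp add: algebra_simps power2_eq_square)
  also have "\<dots> = of_real ((norm k)\<^sup>2)"
    by (simp add: s_power2)
  finally show ?thesis
    unfolding p_def q_def by (simp flip: power_mult_distrib power_mult)
qed

text \<open>If \<open>p\<close> vanished, \<open>p_mult_q\<close> would force \<open>k = 0\<close>;
  there the chosen branch of the root gives \<open>s = \<i> * t\<close>, not its negative.\<close>

lemma p_nonzero: "p \<noteq> 0"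
proof
  assume "p = 0"
  then have "s = - (\<i> * of_real t)" and "k = 0"
    using p_mult_q by (simp_all add: p_def eq_neg_iff_add_eq_0)
  moreover from \<open>k = 0\<close> have "s = \<i> * of_real t"
    unfolding s_def lam_def using t_pos by simp
  ultimately show False
    using t_pos by simp
qed

text \<open>The free amplitude is the one that the transmission condition of that subdomain
  prescribes when the symbol is zero. Both formulas divide by the same nonzero \<open>p\<close>,
  because the second subdomain uses \<open>- s\<close>.\<close>

definition "wave1 b = char_wave Z t k s (Omega1 L) ((- 1 / p) *s (M k *v b)) b"
definition "wave2 a = char_wave Z t k (- s) Omega2 a ((- 1 / p) *s (M k *v a))"

lemma V1_eq: "V1 \<epsilon> \<mu> \<omega> L k = range wave1"
proof -
  have "V1 \<epsilon> \<mu> \<omega> L k = {char_wave Z t k s (Omega1 L) a b |a b. p *s a = - (M k *v b) \<and> q *s b = - (M k *v a)}"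
    unfolding V1_def t_def[symmetric] s_def[symmetric] p_def q_def
    by (rule admissible_eq_range) (use pos in \<open>simp_all add: Omega_open_nonempty Z_def t_def s_power2\<close>)
  then show ?thesis
    unfolding char_relation_iff[OF p_mult_q p_nonzero] wave1_def by auto
qed

lemma V2_eq: "V2 \<epsilon> \<mu> \<omega> k = range wave2"
proof -
  have "V2 \<epsilon> \<mu> \<omega> k = {char_wave Z t k (- s) Omega2 a b |a b.
      (- s + \<i> * of_real t)\<^sup>2 *s a = - (M k *v b) \<and> (- s - \<i> * of_real t)\<^sup>2 *s b = - (M k *v a)}"
    unfolding V2_def t_def[symmetric] s_def[symmetric]
    by (rule admissible_eq_range) (use pos in \<open>simp_all add: Omega_open_nonempty Z_def t_def s_power2\<close>)
  moreover have "(- s + \<i> * of_real t)\<^sup>2 = q" "(- s - \<i> * of_real t)\<^sup>2 = p"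
    by (simp_all add: p_def q_def power2_eq_square algebra_simps)
  moreover have "q *s a = - (M k *v b) \<and> p *s b = - (M k *v a) \<longleftrightarrow> b = (- 1 / p) *s (M k *v a)" for a b
    using char_relation_iff[OF p_mult_q p_nonzero, of b a] by blast
  ultimately show ?thesis
    unfolding wave2_def by auto
qed

text \<open>Since \<open>L \<ge> 0\<close>, both interfaces \<open>x = 0\<close> and
  \<open>x = L\<close> lie in the closures of both subdomains.\<close>

lemma wave1_traces:
  "x \<le> L \<Longrightarrow> w_plus Z x (wave1 b) = plane_wave k (exp (s * of_real x) *s ((- 1 / p) *s (M k *v b)))"
  "x \<le> L \<Longrightarrow> w_minus Z x (wave1 b) = plane_wave k (exp (s * of_real x) *s b)"
  unfolding wave1_def by (rule w_char_wave[OF Z_pos]; simp add: closure_Omega1)+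

lemma wave2_traces:
  "x \<ge> 0 \<Longrightarrow> w_plus Z x (wave2 a) = plane_wave k (exp (- s * of_real x) *s a)"
  "x \<ge> 0 \<Longrightarrow> w_minus Z x (wave2 a) = plane_wave k (exp (- s * of_real x) *s ((- 1 / p) *s (M k *v a)))"
  unfolding wave2_def by (rule w_char_wave[OF Z_pos]; simp add: closure_Omega2)+

lemma inj_wave1: "inj wave1"
proof (rule injI)
  fix b b' assume "wave1 b = wave1 b'"
  then have "w_minus Z 0 (wave1 b) 0 = w_minus Z 0 (wave1 b') 0"
    by simp
  then show "b = b'"
    using pos by (simp add: wave1_traces plane_wave_eq_iff)
qed

lemma inj_wave2: "inj wave2"
proof (rule injI)
  fix a a' assume "wave2 a = wave2 a'"
  then have "w_plus Z 0 (wave2 a) 0 = w_plus Z 0 (wave2 a') 0"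
    by simp
  then show "a = a'"
    by (simp add: wave2_traces plane_wave_eq_iff)
qed

lemma wave_add: "wave1 (v + w) = wave1 v + wave1 w" "wave2 (v + w) = wave2 v + wave2 w"
  by (simp_all add: wave1_def wave2_def matrix_vector_right_distrib vector_add_ldistrib
      flip: char_wave_add)

lemma wave_scale: "wave1 (c *s v) = em_scale c (wave1 v)" "wave2 (c *s v) = em_scale c (wave2 v)"
  by (simp_all add: wave1_def wave2_def M_mult_scale vector_smult_assoc mult.commute
      flip: char_wave_scale)

text \<open>The scalar by which the symbol \<open>\<theta> M\<close> modifies the transfer at its
  interface; it is 1 for \<theta> = 0.\<close>

definition "step \<theta> = (1 - \<theta> * p) / (1 - \<theta> * q)"

context
  fixes S1 S2 :: trace_op and \<theta>1 \<theta>2 :: complex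
  assumes S1: "\<And>v. S1 (plane_wave k v) = plane_wave k (\<theta>1 *s (M k *v v))"
    and S2: "\<And>v. S2 (plane_wave k v) = plane_wave k (\<theta>2 *s (M k *v v))"
    and nz: "1 - \<theta>1 * q \<noteq> 0" "1 - \<theta>2 * q \<noteq> 0"
begin

text \<open>Amplitude form of the two solves. At \<open>x = L\<close> the two fields carry
  exponentials with opposite exponents, whose quotient is the factor in \<open>next1\<close>; at
  \<open>x = 0\<close> both exponentials are 1.\<close>

definition "next1 a = (- exp (- 2 * s * of_real L) * step \<theta>1 / p) *s (M k *v a)"
definition "next2 b = (- step \<theta>2 / p) *s (M k *v b)"

lemma transmission12_iff: "transmission12 Z L S1 (wave1 b) (wave2 a) \<longleftrightarrow> b = next1 a"
proof -
  have "exp (- s * of_real L) / exp (s * of_real L) = exp (- 2 * s * of_real L)"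
    by (simp add: mult_ac flip: exp_diff)
  then have "- (exp (- s * of_real L) / exp (s * of_real L)) * (1 - \<theta>1 * p) / (p * (1 - \<theta>1 * q))
      = - exp (- 2 * s * of_real L) * step \<theta>1 / p"
    unfolding step_def by simp
  then show ?thesis
    using interface_eq_iff[OF p_mult_q p_nonzero exp_not_eq_zero nz(1)] pos
    unfolding transmission12_def next1_def
    by (simp only: wave1_traces wave2_traces S1 plane_wave_add plane_wave_eq_iff simp_thms order_refl)
qed

lemma transmission21_iff: "transmission21 Z S2 (wave2 a) (wave1 b) \<longleftrightarrow> a = next2 b"
proof -
  have "- (1 / 1) * (1 - \<theta>2 * p) / (p * (1 - \<theta>2 * q)) = - step \<theta>2 / p"
    unfolding step_def by (simp add: mult.commute minus_divide_left)
  then show ?thesis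
    using interface_eq_iff[OF p_mult_q p_nonzero one_neq_zero nz(2), of a 1 b] pos
    unfolding transmission21_def next2_def
    by (simp add: wave1_traces wave2_traces S2 plane_wave_add plane_wave_eq_iff)
qed

lemma solve1_wave2: "solve1 \<epsilon> \<mu> \<omega> L S1 k (wave2 a) = wave1 (next1 a)"
  unfolding solve1_def V1_eq Z_def[symmetric]
  by (rule the_equality) (auto simp: transmission12_iff)

lemma solve2_wave1: "solve2 \<epsilon> \<mu> \<omega> S2 k (wave1 b) = wave2 (next2 b)"
  unfolding solve2_def V2_eq Z_def[symmetric]
  by (rule the_equality) (auto simp: transmission21_iff)

lemma iteration_well_defined: "iteration_well_defined \<epsilon> \<mu> \<omega> L S1 S2 k"
proof -
  have "\<exists>!u1. u1 \<in> range wave1 \<and> transmission12 Z L S1 u1 (wave2 a)" for a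
    by (rule ex1I[of _ "wave1 (next1 a)"]) (auto simp: transmission12_iff)
  moreover have "\<exists>!u2. u2 \<in> range wave2 \<and> transmission21 Z S2 u2 (wave1 b)" for b
    by (rule ex1I[of _ "wave2 (next2 b)"]) (auto simp: transmission21_iff)
  ultimately show ?thesis
    unfolding iteration_well_defined_def V1_eq V2_eq Z_def[symmetric] by blast
qed

lemma has_convergence_factor:
  "has_convergence_factor \<epsilon> \<mu> \<omega> L S1 S2 k
     (cmod (q / p * step \<theta>1 * step \<theta>2 * exp (- 2 * s * of_real L)) powr (1/2))"
proof -
  define c where "c = q / p * step \<theta>1 * step \<theta>2 * exp (- 2 * s * of_real L)"
  \<comment> \<open>The two signs cancel, and the square of \<open>M\<close> contributes
    \<open>p * q\<close> against two divisions by \<open>p\<close>, leaving \<open>q / p\<close> in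
    either order.\<close>
  have "next1 (next2 v) = c *s v" "next2 (next1 v) = c *s v" for v
    unfolding next1_def next2_def M_mult_scale M_mult_M p_mult_q[symmetric] vector_smult_assoc
    using p_nonzero by (simp_all add: c_def field_simps)
  then have T: "(solve1 \<epsilon> \<mu> \<omega> L S1 k \<circ> solve2 \<epsilon> \<mu> \<omega> S2 k) (wave1 v) = em_scale c (wave1 v)"
    "(solve2 \<epsilon> \<mu> \<omega> S2 k \<circ> solve1 \<epsilon> \<mu> \<omega> L S1 k) (wave2 v) = em_scale c (wave2 v)" for v
    by (simp_all add: solve1_wave2 solve2_wave1 wave_scale)
  have "two_step_factor (V1 \<epsilon> \<mu> \<omega> L k) (solve1 \<epsilon> \<mu> \<omega> L S1 k \<circ> solve2 \<epsilon> \<mu> \<omega> S2 k) (sqrt (cmod c))"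
    unfolding V1_eq by (rule two_step_factor_scalar[OF wave_add(1) wave_scale(1) inj_wave1 T(1)])
  moreover have "two_step_factor (V2 \<epsilon> \<mu> \<omega> k) (solve2 \<epsilon> \<mu> \<omega> S2 k \<circ> solve1 \<epsilon> \<mu> \<omega> L S1 k) (sqrt (cmod c))"
    unfolding V2_eq by (rule two_step_factor_scalar[OF wave_add(2) wave_scale(2) inj_wave2 T(2)])
  ultimately show ?thesis
    using iteration_well_defined
    by (simp add: has_convergence_factor_def c_def powr_half_sqrt)
qed

end

section \<open>Reduction of inverse symbols to multiples of \<open>M\<close>\<close>

lemma q_nonzero: "k \<noteq> 0 \<Longrightarrow> q \<noteq> 0"
  using p_mult_q by auto

text \<open>As the square of \<open>M k\<close> is the scalar \<open>p * q\<close>, its inverse is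
  \<open>M k\<close> divided by that scalar.\<close>

lemma matrix_inv_M:
  assumes "k \<noteq> 0"
  shows "scale_mat \<delta> (matrix_inv (M k)) *v v = (\<delta> / (p * q)) *s (M k *v v)"
proof -
  have nz: "p * q \<noteq> 0"
    using p_nonzero q_nonzero[OF assms] by simp
  let ?N = "scale_mat (1 / (p * q)) (M k)"
  have "M k ** ?N = mat 1" "?N ** M k = mat 1"
    unfolding matrix_eq
    using nz by (simp_all add: scale_mat_mult_vec M_mult_scale M_mult_M vector_smult_assoc p_mult_q
        flip: matrix_vector_mul_assoc)
  then have "matrix_inv (M k) = ?N"
    by (rule matrix_inv_unique)
  then show ?thesis
    by (simp add: scale_mat_mult_vec vector_smult_assoc)
qed

text \<open>Clearing denominators in \<open>step\<close> leaves an extra \<open>p / q\<close> for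
  each inverse symbol.\<close>

lemma step_inverse_symbol:
  assumes "k \<noteq> 0" "\<delta> - p \<noteq> 0"
  shows "1 - \<delta> / (p * q) * q \<noteq> 0"
    and "step (\<delta> / (p * q)) = p / q * ((\<delta> - q) / (\<delta> - p))"
proof -
  have "1 - \<delta> / (p * q) * q = - (\<delta> - p) / p" "1 - \<delta> / (p * q) * p = - (\<delta> - q) / q"
    using p_nonzero q_nonzero[OF assms(1)] by (simp_all add: field_simps)
  note eqs = this
  show "1 - \<delta> / (p * q) * q \<noteq> 0"
    unfolding eqs using p_nonzero assms(2) by simp
  have "- (\<delta> - q) / q / (- (\<delta> - p) / p) = p / q * ((\<delta> - q) / (\<delta> - p))"
    by (simp only: divide_minus_left minus_divide_divide) simp
  then show "step (\<delta> / (p * q)) = p / q * ((\<delta> - q) / (\<delta> - p))"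
    by (simp only: step_def eqs)
qed

end

theorem theorem3p3:
  fixes \<epsilon> \<mu> \<omega> L \<omega>t :: real
    and S1 S2 :: trace_op
    and k :: "real \<times> real" and s :: complex
  assumes "\<epsilon> > 0" and "\<mu> > 0" and "\<omega> > 0" and "L \<ge> 0"
    and "\<omega>t = \<omega> * sqrt (\<epsilon> * \<mu>)"
    and "norm k \<noteq> \<omega>t"
    and "s = lam \<omega>t k"
  shows
    "(\<forall>\<gamma>1 \<gamma>2 :: ratfun.
        has_fourier_symbol S1 (rat_dom \<gamma>1) (\<lambda>\<kappa>. scale_mat (rat_at \<gamma>1 \<kappa>) (M \<kappa>)) \<and>
        has_fourier_symbol S2 (rat_dom \<gamma>2) (\<lambda>\<kappa>. scale_mat (rat_at \<gamma>2 \<kappa>) (M \<kappa>)) \<and>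
        k \<in> rat_dom \<gamma>1 \<and> k \<in> rat_dom \<gamma>2 \<and>
        1 - rat_at \<gamma>1 k * (s - \<i> * \<omega>t)\<^sup>2 \<noteq> 0 \<and> 1 - rat_at \<gamma>2 k * (s - \<i> * \<omega>t)\<^sup>2 \<noteq> 0 \<longrightarrow>
        has_convergence_factor \<epsilon> \<mu> \<omega> L S1 S2 k
          (cmod ((s - \<i> * \<omega>t)\<^sup>2 / (s + \<i> * \<omega>t)\<^sup>2
                 * ((1 - rat_at \<gamma>1 k * (s + \<i> * \<omega>t)\<^sup>2) / (1 - rat_at \<gamma>1 k * (s - \<i> * \<omega>t)\<^sup>2))
                 * ((1 - rat_at \<gamma>2 k * (s + \<i> * \<omega>t)\<^sup>2) / (1 - rat_at \<gamma>2 k * (s - \<i> * \<omega>t)\<^sup>2))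
                 * exp (- 2 * s * L)) powr (1/2)))
     \<and>
     (\<forall>\<delta>1 \<delta>2 :: ratfun.
        has_fourier_symbol S1 (rat_dom \<delta>1 - {0}) (\<lambda>\<kappa>. scale_mat (rat_at \<delta>1 \<kappa>) (matrix_inv (M \<kappa>))) \<and>
        has_fourier_symbol S2 (rat_dom \<delta>2 - {0}) (\<lambda>\<kappa>. scale_mat (rat_at \<delta>2 \<kappa>) (matrix_inv (M \<kappa>))) \<and>
        k \<in> rat_dom \<delta>1 \<and> k \<in> rat_dom \<delta>2 \<and> k \<noteq> 0 \<and>
        rat_at \<delta>1 k - (s + \<i> * \<omega>t)\<^sup>2 \<noteq> 0 \<and> rat_at \<delta>2 k - (s + \<i> * \<omega>t)\<^sup>2 \<noteq> 0 \<longrightarrow>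
        has_convergence_factor \<epsilon> \<mu> \<omega> L S1 S2 k
          (cmod ((s + \<i> * \<omega>t)\<^sup>2 / (s - \<i> * \<omega>t)\<^sup>2
                 * ((rat_at \<delta>1 k - (s - \<i> * \<omega>t)\<^sup>2) / (rat_at \<delta>1 k - (s + \<i> * \<omega>t)\<^sup>2))
                 * ((rat_at \<delta>2 k - (s - \<i> * \<omega>t)\<^sup>2) / (rat_at \<delta>2 k - (s + \<i> * \<omega>t)\<^sup>2))
                 * exp (- 2 * s * L)) powr (1/2)))
     \<and>
     (\<forall>\<gamma>1 \<delta>2 :: ratfun.
        has_fourier_symbol S1 (rat_dom \<gamma>1) (\<lambda>\<kappa>. scale_mat (rat_at \<gamma>1 \<kappa>) (M \<kappa>)) \<and>
        has_fourier_symbol S2 (rat_dom \<delta>2 - {0}) (\<lambda>\<kappa>. scale_mat (rat_at \<delta>2 \<kappa>) (matrix_inv (M \<kappa>))) \<and>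
        k \<in> rat_dom \<gamma>1 \<and> k \<in> rat_dom \<delta>2 \<and> k \<noteq> 0 \<and>
        1 - rat_at \<gamma>1 k * (s - \<i> * \<omega>t)\<^sup>2 \<noteq> 0 \<and> rat_at \<delta>2 k - (s + \<i> * \<omega>t)\<^sup>2 \<noteq> 0 \<longrightarrow>
        has_convergence_factor \<epsilon> \<mu> \<omega> L S1 S2 k
          (cmod ((1 - rat_at \<gamma>1 k * (s + \<i> * \<omega>t)\<^sup>2) / (1 - rat_at \<gamma>1 k * (s - \<i> * \<omega>t)\<^sup>2)
                 * ((rat_at \<delta>2 k - (s - \<i> * \<omega>t)\<^sup>2) / (rat_at \<delta>2 k - (s + \<i> * \<omega>t)\<^sup>2))
                 * exp (- 2 * s * L)) powr (1/2)))"
proof -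
  interpret schwarz_mode \<epsilon> \<mu> \<omega> L k
    using assms by unfold_locales
  have t: "\<omega>t = t" and s: "s = schwarz_mode.s \<epsilon> \<mu> \<omega> k"
    using assms(5,7) by (simp_all add: t_def s_def)
  \<comment> \<open>These fold the literal squares of the statement into the \<open>p\<close> and
    \<open>q\<close> of the locale.\<close>
  note pq = p_def[symmetric, folded s t] q_def[symmetric, folded s t]
  have M_symbol: "S (plane_wave k v) = plane_wave k (rat_at \<gamma> k *s (M k *v v))"
    if "has_fourier_symbol S (rat_dom \<gamma>) (\<lambda>\<kappa>. scale_mat (rat_at \<gamma> \<kappa>) (M \<kappa>))" "k \<in> rat_dom \<gamma>"
    for S \<gamma> v
    using that by (simp add: has_fourier_symbol_def scale_mat_mult_vec)
  have inv_symbol: "S (plane_wave k v) = plane_wave k ((rat_at \<delta> k / (p * q)) *s (M k *v v))"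
    if "has_fourier_symbol S (rat_dom \<delta> - {0}) (\<lambda>\<kappa>. scale_mat (rat_at \<delta> \<kappa>) (matrix_inv (M \<kappa>)))"
      "k \<in> rat_dom \<delta>" "k \<noteq> 0" for S \<delta> v
    using that by (simp add: has_fourier_symbol_def matrix_inv_M)
  show ?thesis
    unfolding pq
  proof (intro conjI allI impI; elim conjE)
    fix \<gamma>1 \<gamma>2
    assume S: "has_fourier_symbol S1 (rat_dom \<gamma>1) (\<lambda>\<kappa>. scale_mat (rat_at \<gamma>1 \<kappa>) (M \<kappa>))"
      "has_fourier_symbol S2 (rat_dom \<gamma>2) (\<lambda>\<kappa>. scale_mat (rat_at \<gamma>2 \<kappa>) (M \<kappa>))"
      and dom: "k \<in> rat_dom \<gamma>1" "k \<in> rat_dom \<gamma>2"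
      and nz: "1 - rat_at \<gamma>1 k * q \<noteq> 0" "1 - rat_at \<gamma>2 k * q \<noteq> 0"
    show "has_convergence_factor \<epsilon> \<mu> \<omega> L S1 S2 k
      (cmod (q / p * ((1 - rat_at \<gamma>1 k * p) / (1 - rat_at \<gamma>1 k * q))
         * ((1 - rat_at \<gamma>2 k * p) / (1 - rat_at \<gamma>2 k * q)) * exp (- 2 * s * L)) powr (1/2))"
      using has_convergence_factor[OF M_symbol[OF S(1) dom(1)] M_symbol[OF S(2) dom(2)] nz]
      by (simp only: step_def s)
  next
    fix \<delta>1 \<delta>2
    assume S: "has_fourier_symbol S1 (rat_dom \<delta>1 - {0}) (\<lambda>\<kappa>. scale_mat (rat_at \<delta>1 \<kappa>) (matrix_inv (M \<kappa>)))"
      "has_fourier_symbol S2 (rat_dom \<delta>2 - {0}) (\<lambda>\<kappa>. scale_mat (rat_at \<delta>2 \<kappa>) (matrix_inv (M \<kappa>)))"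
      and dom: "k \<in> rat_dom \<delta>1" "k \<in> rat_dom \<delta>2" and k: "k \<noteq> 0"
      and nz: "rat_at \<delta>1 k - p \<noteq> 0" "rat_at \<delta>2 k - p \<noteq> 0"
    \<comment> \<open>Two factors \<open>p / q\<close> invert the prefactor
      \<open>q / p\<close>.\<close>
    have "q / p * step (rat_at \<delta>1 k / (p * q)) * step (rat_at \<delta>2 k / (p * q)) =
      p / q * ((rat_at \<delta>1 k - q) / (rat_at \<delta>1 k - p)) * ((rat_at \<delta>2 k - q) / (rat_at \<delta>2 k - p))"
      unfolding step_inverse_symbol(2)[OF k nz(1)] step_inverse_symbol(2)[OF k nz(2)]
      using p_nonzero q_nonzero[OF k] by (simp add: mult_ac)
    then show "has_convergence_factor \<epsilon> \<mu> \<omega> L S1 S2 k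
      (cmod (p / q * ((rat_at \<delta>1 k - q) / (rat_at \<delta>1 k - p))
         * ((rat_at \<delta>2 k - q) / (rat_at \<delta>2 k - p)) * exp (- 2 * s * L)) powr (1/2))"
      using has_convergence_factor[OF inv_symbol[OF S(1) dom(1) k] inv_symbol[OF S(2) dom(2) k]
          step_inverse_symbol(1)[OF k nz(1)] step_inverse_symbol(1)[OF k nz(2)]]
      by (simp only: s)
  next
    fix \<gamma>1 \<delta>2
    assume S: "has_fourier_symbol S1 (rat_dom \<gamma>1) (\<lambda>\<kappa>. scale_mat (rat_at \<gamma>1 \<kappa>) (M \<kappa>))"
      "has_fourier_symbol S2 (rat_dom \<delta>2 - {0}) (\<lambda>\<kappa>. scale_mat (rat_at \<delta>2 \<kappa>) (matrix_inv (M \<kappa>)))"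
      and dom: "k \<in> rat_dom \<gamma>1" "k \<in> rat_dom \<delta>2" and k: "k \<noteq> 0"
      and nz: "1 - rat_at \<gamma>1 k * q \<noteq> 0" "rat_at \<delta>2 k - p \<noteq> 0"
    \<comment> \<open>A single factor \<open>p / q\<close> cancels the prefactor, so the mixed case
      has none.\<close>
    have "q / p * step (rat_at \<gamma>1 k) * step (rat_at \<delta>2 k / (p * q)) =
      (1 - rat_at \<gamma>1 k * p) / (1 - rat_at \<gamma>1 k * q) * ((rat_at \<delta>2 k - q) / (rat_at \<delta>2 k - p))"
      unfolding step_inverse_symbol(2)[OF k nz(2)] unfolding step_def
      using p_nonzero q_nonzero[OF k] by simp
    then show "has_convergence_factor \<epsilon> \<mu> \<omega> L S1 S2 k
      (cmod ((1 - rat_at \<gamma>1 k * p) / (1 - rat_at \<gamma>1 k * q)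
         * ((rat_at \<delta>2 k - q) / (rat_at \<delta>2 k - p)) * exp (- 2 * s * L)) powr (1/2))"
      using has_convergence_factor[OF M_symbol[OF S(1) dom(1)] inv_symbol[OF S(2) dom(2) k]
          nz(1) step_inverse_symbol(1)[OF k nz(2)]]
      by (simp only: s)
  qed
qed

end
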